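(* Let $k$ be a positive integer. Any $k$-in-out graph with exactly $2k-1$ vertices contains at least $4k-4$ directed edges.
   Context: All graphs are simple, finite, directed graphs; edges are counted as directed edges (a pair of opposite edges $(a,b),(b,a)$ counts as two). A Hamiltonian path in a directed graph $S$ from $u$ to $w$ is a directed simple path starting at $u$, ending at $w$, and visiting every vertex of $S$ exactly once. Let $S$ be a directed graph in which $k$ distinct vertices are labelled $i_1,\dots,i_k$ (the incoming vertices) and $k$ distinct vertices are labelled $o_1,\dots,o_k$ (the outgoing vertices); a vertex may be both an incoming and an outgoing vertex. $S$ is called a $k$-in-out graph if: (1) (paired vertices condition) for all $j,m\in\{1,\dots,k\}$, there is a Hamiltonian path in $S$ from $i_j$ to $o_m$ if and only if $j=m$; and (2) (single visit condition) there is no collection of two or more pairwise vertex-disjoint directed paths in $S$, each starting at an incoming vertex and finishing at an outgoing vertex (a single vertex that is both incoming and outgoing counts as such a path), whose union covers all vertices of $S$. *)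

theory Defs
  imports "Graph_Theory.Graph_Theory"
begin

text \<open>The library locale \<^locale>\<open>digraph\<close> describes finite directed graphs without loops and
  without parallel arcs. Opposite arcs are allowed and are two elements of \<^const>\<open>arcs\<close>.
  Paths are nonempty vertex lists, and a one-element list is a path.\<close>

definition hamiltonian_path :: "('a, 'b) pre_digraph \<Rightarrow> 'a \<Rightarrow> 'a list \<Rightarrow> 'a \<Rightarrow> bool" where
  "hamiltonian_path S u p w \<longleftrightarrow> vpath p S \<and> hd p = u \<and> last p = w \<and> set p = verts S"

definition paired_vertices_condition ::
  "('a, 'b) pre_digraph \<Rightarrow> nat \<Rightarrow> (nat \<Rightarrow> 'a) \<Rightarrow> (nat \<Rightarrow> 'a) \<Rightarrow> bool" where
  "paired_vertices_condition S k inc out \<longleftrightarrow>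
     (\<forall>j\<in>{1..k}. \<forall>m\<in>{1..k}. (\<exists>p. hamiltonian_path S (inc j) p (out m)) \<longleftrightarrow> j = m)"

text \<open>A collection is taken as a set of paths: pairwise disjoint nonempty paths are
  distinct, and \<open>card P \<ge> 2\<close> includes finiteness, which is automatic in a finite graph.\<close>

definition single_visit_condition ::
  "('a, 'b) pre_digraph \<Rightarrow> nat \<Rightarrow> (nat \<Rightarrow> 'a) \<Rightarrow> (nat \<Rightarrow> 'a) \<Rightarrow> bool" where
  "single_visit_condition S k inc out \<longleftrightarrow>
     \<not> (\<exists>P. card P \<ge> 2 \<and>
            (\<forall>p\<in>P. vpath p S \<and> hd p \<in> inc ` {1..k} \<and> last p \<in> out ` {1..k}) \<and>
            (\<forall>p\<in>P. \<forall>q\<in>P. p \<noteq> q \<longrightarrow> set p \<inter> set q = {}) \<and>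
            (\<Union>p\<in>P. set p) = verts S)"

definition in_out_graph ::
  "nat \<Rightarrow> ('a, 'b) pre_digraph \<Rightarrow> (nat \<Rightarrow> 'a) \<Rightarrow> (nat \<Rightarrow> 'a) \<Rightarrow> bool" where
  "in_out_graph k S inc out \<longleftrightarrow>
     digraph S \<and>
     inj_on inc {1..k} \<and> inc ` {1..k} \<subseteq> verts S \<and>
     inj_on out {1..k} \<and> out ` {1..k} \<subseteq> verts S \<and>
     paired_vertices_condition S k inc out \<and>
     single_visit_condition S k inc out"

end

theory Submission
  imports Defs
begin

text \<open>Let \<open>I\<close> and \<open>O\<close> be the sets of incoming and outgoing vertices. By the single visit condition, a
  Hamiltonian path from \<open>i\<^sub>j\<close> to \<open>o\<^sub>j\<close> never steps from \<open>O\<close> to \<open>I\<close>, as it could be cut there. So it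
  injects the \<open>k - 1\<close> vertices of \<open>O - {o\<^sub>j}\<close> into the complement of \<open>I\<close>, which also has only \<open>k - 1\<close>
  vertices. Hence the predecessor of a vertex outside \<open>I\<close> always lies in \<open>O - {o\<^sub>j}\<close>, and the
  successor of a vertex outside \<open>O\<close> always lies in \<open>I - {i\<^sub>j}\<close>. Varying \<open>j\<close>, each of the \<open>k - 1\<close>
  vertices outside \<open>O\<close> has two out-neighbours in \<open>I\<close>, and each of the \<open>k - 1\<close> vertices outside \<open>I\<close>
  has two in-neighbours in \<open>O\<close>. These \<open>2 (k - 1) + 2 (k - 1)\<close> arcs are distinct because the former
  start outside \<open>O\<close> and the latter inside.\<close>

lemma vpath_take_drop:
  assumes "vpath p S" and "Suc i < length p"
  shows "vpath (take (Suc i) p) S" "vpath (drop (Suc i) p) S"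
    and "(p ! i, p ! Suc i) \<in> arcs_ends S"
proof -
  let ?q = "take (Suc i) p" and ?r = "drop (Suc i) p"
  have ne: "?q \<noteq> []" "?r \<noteq> []"
    using assms(2) by auto
  have w: "vwalk (?q @ ?r) S" "distinct p"
    using assms(1) by (auto simp: vpath_def)
  show "vpath ?q S" "vpath ?r S"
    using vwalkI_append_l[OF ne(1) w(1)] vwalkI_append_r[OF ne(2) w(1)] w(2)
    by (auto simp: vpath_def)
  have "(last ?q, hd ?r) \<in> arcs_ends S"
    using w(1) vwalk_arcs_append[OF ne] by (auto simp: vwalk_def)
  moreover have "last ?q = p ! i" "hd ?r = p ! Suc i"
    using assms(2) by (simp_all add: take_Suc_conv_app_nth hd_drop_conv_nth)
  ultimately show "(p ! i, p ! Suc i) \<in> arcs_ends S"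
    by simp
qed

text \<open>Cutting the path between the two vertices would leave two disjoint paths from incoming
  to outgoing vertices that still cover the graph.\<close>

lemma single_visit_no_out_inc_step:
  assumes "single_visit_condition S k inc out"
    and p: "hamiltonian_path S u p w"
    and u: "u \<in> inc ` {1..k}" and w: "w \<in> out ` {1..k}"
    and i: "Suc i < length p" and oi: "p ! i \<in> out ` {1..k}"
  shows "p ! Suc i \<notin> inc ` {1..k}"
proof
  assume inci: "p ! Suc i \<in> inc ` {1..k}"
  let ?q = "take (Suc i) p" and ?r = "drop (Suc i) p"
  have vp: "vpath p S" "hd p = u" "last p = w" "set p = verts S"
    using p by (auto simp: hamiltonian_path_def)
  have "distinct (?q @ ?r)"
    using vp(1) by (simp add: vpath_def del: distinct_append)
  then have disj: "set ?q \<inter> set ?r = {}"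
    by (simp only: distinct_append)
  have "?q \<noteq> []"
    using i by auto
  then have "?q \<noteq> ?r"
    using disj by (metis Int_absorb set_empty)
  have ends: "hd ?q = u" "last ?r = w" "last ?q = p ! i" "hd ?r = p ! Suc i"
    using i vp(2,3) by (simp, simp, simp add: take_Suc_conv_app_nth, simp add: hd_drop_conv_nth)
  have "card {?q, ?r} \<ge> 2"
    using \<open>?q \<noteq> ?r\<close> by simp
  moreover have "\<forall>s\<in>{?q, ?r}. vpath s S \<and> hd s \<in> inc ` {1..k} \<and> last s \<in> out ` {1..k}"
    using vpath_take_drop[OF vp(1) i] ends u w oi inci by simp
  moreover have "\<forall>s\<in>{?q, ?r}. \<forall>t\<in>{?q, ?r}. s \<noteq> t \<longrightarrow> set s \<inter> set t = {}"
    using disj by auto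
  moreover have "(\<Union>s\<in>{?q, ?r}. set s) = verts S"
    using vp(4) by (metis append_take_drop_id set_append UN_insert UN_empty sup_bot_right)
  ultimately show False
    using assms(1) unfolding single_visit_condition_def by blast
qed

text \<open>The forward direction is the single visit condition. The converse is counting: with
  \<open>2 * k - 1\<close> vertices, each side holds at exactly \<open>k - 1\<close> steps, so the
  inclusion between the two sets of steps is an equality.\<close>

lemma hamiltonian_path_step_iff:
  assumes G: "in_out_graph k S inc out" and card: "card (verts S) = 2 * k - 1"
    and j: "j \<in> {1..k}" and p: "hamiltonian_path S (inc j) p (out j)"
    and i: "Suc i < length p"
  shows "p ! i \<in> out ` {1..k} \<longleftrightarrow> p ! Suc i \<notin> inc ` {1..k}"
proof -
  let ?I = "inc ` {1..k}" and ?O = "out ` {1..k}"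
  define n where "n = length p - 1"
  have len: "length p = Suc n"
    using i by (simp add: n_def)
  have vp: "distinct p" "hd p = inc j" "last p = out j" "set p = verts S"
    using p by (auto simp: hamiltonian_path_def vpath_def)
  have ends: "p ! 0 = inc j" "p ! n = out j"
    using vp(2,3) len hd_conv_nth[of p] last_conv_nth[of p] by force+
  have sub: "?I \<subseteq> verts S" "?O \<subseteq> verts S" and cI: "card ?I = k" and cO: "card ?O = k"
    using G by (auto simp: in_out_graph_def card_image)
  let ?A = "{m. m < n \<and> p ! m \<in> ?O}" and ?D = "{m. m < n \<and> p ! Suc m \<notin> ?I}"
  \<comment> \<open>Only the last position \<open>n\<close> starts no step, and it holds
    \<open>out j\<close>.\<close>
  have "(!) p ` ?A = ?O - {out j}"
  proof (intro equalityI subsetI)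
    fix x assume "x \<in> (!) p ` ?A"
    then obtain m where "m < n" "x = p ! m" "x \<in> ?O"
      by auto
    then show "x \<in> ?O - {out j}"
      using nth_eq_iff_index_eq[OF vp(1), of m n] len ends by auto
  next
    fix x assume x: "x \<in> ?O - {out j}"
    then obtain m where "m < Suc n" "p ! m = x"
      using sub(2) vp(4) len by (metis DiffD1 in_set_conv_nth subsetD)
    then show "x \<in> (!) p ` ?A"
      using x ends less_Suc_eq by auto
  qed
  moreover have "inj_on ((!) p) ?A"
    using vp(1) len by (auto intro!: inj_on_nth)
  ultimately have cA: "card ?A = k - 1"
    using cO j by (metis card_Diff_singleton card_image imageI)
  \<comment> \<open>Position 0 holds \<open>inc j\<close>, so every vertex outside \<open>?I\<close>
    is the end of some step.\<close>
  have "(\<lambda>m. p ! Suc m) ` ?D = verts S - ?I"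
  proof (intro equalityI subsetI)
    fix x assume "x \<in> (\<lambda>m. p ! Suc m) ` ?D"
    then show "x \<in> verts S - ?I"
      using vp(4) len nth_mem by fastforce
  next
    fix x assume x: "x \<in> verts S - ?I"
    then obtain m where m: "m < Suc n" "p ! m = x"
      using vp(4) len by (metis DiffD1 in_set_conv_nth)
    moreover have "m \<noteq> 0"
      using x m ends j by auto
    ultimately show "x \<in> (\<lambda>m. p ! Suc m) ` ?D"
      using x by (cases m) auto
  qed
  moreover have "card ((\<lambda>m. p ! Suc m) ` ?D) = card ?D"
    using vp(1) len by (intro card_image inj_onI) (auto simp: nth_eq_iff_index_eq)
  ultimately have "card ?D = card (verts S - ?I)"
    by simp
  also have "\<dots> = k - 1"
    using card cI sub(1) by (simp add: card_Diff_subset)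
  finally have cD: "card ?D = k - 1" .
  have "?A \<subseteq> ?D"
  proof
    fix m assume m: "m \<in> ?A"
    have "p ! Suc m \<notin> ?I"
    proof (rule single_visit_no_out_inc_step[OF _ p])
      show "single_visit_condition S k inc out"
        using G by (simp add: in_out_graph_def)
    qed (use j m len in simp_all)
    with m show "m \<in> ?D"
      by blast
  qed
  then have "?A = ?D"
    using cA cD by (intro card_subset_eq) auto
  then have "i \<in> ?A \<longleftrightarrow> i \<in> ?D"
    by (rule arg_cong)
  then show ?thesis
    using i len by simp
qed

text \<open>The neighbour is the successor of \<open>x\<close> on the \<open>j\<close>-th
  Hamiltonian path. It exists since the path ends in an outgoing vertex, and it differs from
  \<open>inc j\<close>, the first vertex of the path.\<close>

lemma out_neighbour_in_inc:
  assumes G: "in_out_graph k S inc out" and card: "card (verts S) = 2 * k - 1"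
    and j: "j \<in> {1..k}" and x: "x \<in> verts S" "x \<notin> out ` {1..k}"
  shows "\<exists>y\<in>inc ` {1..k}. y \<noteq> inc j \<and> (x, y) \<in> arcs_ends S"
proof -
  obtain p where p: "hamiltonian_path S (inc j) p (out j)"
    using G j unfolding in_out_graph_def paired_vertices_condition_def by blast
  have vp: "vpath p S" "distinct p" "hd p = inc j" "last p = out j" "set p = verts S"
    using p by (auto simp: hamiltonian_path_def vpath_def)
  obtain i where i: "i < length p" "p ! i = x"
    using x vp by (metis in_set_conv_nth)
  have "x \<noteq> last p"
    using x j vp by auto
  then have "i \<noteq> length p - 1"
    using i by (metis last_conv_nth list.size(3) not_less_zero)
  then have si: "Suc i < length p"
    using i by simp
  have "p ! Suc i \<noteq> p ! 0"
    using vp(2) si by (subst nth_eq_iff_index_eq) auto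
  then have "p ! Suc i \<noteq> inc j"
    using vp(3) si by (metis hd_conv_nth list.size(3) not_less_zero)
  then show ?thesis
    using hamiltonian_path_step_iff[OF G card j p si] vpath_take_drop(3)[OF vp(1) si] i x by auto
qed

text \<open>Mirror image of the previous argument: the predecessor of \<open>y\<close> is used, and
  it cannot be the last vertex \<open>out j\<close>.\<close>

lemma in_neighbour_in_out:
  assumes G: "in_out_graph k S inc out" and card: "card (verts S) = 2 * k - 1"
    and j: "j \<in> {1..k}" and y: "y \<in> verts S" "y \<notin> inc ` {1..k}"
  shows "\<exists>x\<in>out ` {1..k}. x \<noteq> out j \<and> (x, y) \<in> arcs_ends S"
proof -
  obtain p where p: "hamiltonian_path S (inc j) p (out j)"
    using G j unfolding in_out_graph_def paired_vertices_condition_def by blast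
  have vp: "vpath p S" "distinct p" "hd p = inc j" "last p = out j" "set p = verts S"
    using p by (auto simp: hamiltonian_path_def vpath_def)
  obtain m where m: "m < length p" "p ! m = y"
    using y vp by (metis in_set_conv_nth)
  have "y \<noteq> hd p"
    using y j vp by auto
  then have "m \<noteq> 0"
    using m by (metis hd_conv_nth list.size(3) not_less_zero)
  then obtain i where i: "m = Suc i"
    by (cases m) auto
  then have si: "Suc i < length p"
    using m by simp
  have "p ! i \<noteq> p ! (length p - 1)"
    using vp(2) si by (subst nth_eq_iff_index_eq) auto
  then have "p ! i \<noteq> out j"
    using vp(4) si by (metis last_conv_nth list.size(3) not_less_zero)
  then show ?thesis
    using hamiltonian_path_step_iff[OF G card j p si] vpath_take_drop(3)[OF vp(1) si] i m y by auto
qed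

text \<open>Any first witness has the form \<open>f m\<close>; avoiding the index \<open>m\<close>
  then yields a second one.\<close>

lemma two_le_card_if_avoiding:
  assumes "finite J" and "J \<noteq> {}"
    and avoid: "\<And>j. j \<in> J \<Longrightarrow> \<exists>y\<in>f ` J. y \<noteq> f j \<and> Q y"
  shows "2 \<le> card {y \<in> f ` J. Q y}"
proof -
  obtain m where m: "m \<in> J" "Q (f m)"
    using assms(2) avoid by blast
  then obtain y where y: "y \<in> f ` J" "y \<noteq> f m" "Q y"
    using avoid by blast
  have "card {f m, y} \<le> card {y \<in> f ` J. Q y}"
    using assms(1) m y by (intro card_mono) auto
  then show ?thesis
    using y(2) by simp
qed

lemma card_restrict_ge_two_mult:
  assumes "finite A" and "finite B" and "\<And>x. x \<in> A \<Longrightarrow> 2 \<le> card {y \<in> B. (x, y) \<in> E}"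
  shows "2 * card A \<le> card (E \<inter> A \<times> B)"
proof -
  have "E \<inter> A \<times> B = (SIGMA x:A. {y \<in> B. (x, y) \<in> E})"
    by auto
  moreover have "2 * card A \<le> (\<Sum>x\<in>A. card {y \<in> B. (x, y) \<in> E})"
    using sum_mono[of A "\<lambda>_. 2" "\<lambda>x. card {y \<in> B. (x, y) \<in> E}"] assms(3) by simp
  ultimately show ?thesis
    using assms(1,2) by (simp add: card_SigmaI)
qed

theorem theorem1:
  fixes k :: nat
    and S :: "('a, 'b) pre_digraph"
    and inc out :: "nat \<Rightarrow> 'a"
  assumes "k \<ge> 1"
    and "in_out_graph k S inc out"
    and "card (verts S) = 2 * k - 1"
  shows "card (arcs S) \<ge> 4 * k - 4"
proof -
  let ?I = "inc ` {1..k}" and ?O = "out ` {1..k}" and ?V = "verts S" and ?E = "arcs_ends S"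
  interpret digraph S
    using assms(2) by (simp add: in_out_graph_def)
  have J: "finite {1..k}" "{1..k} \<noteq> {}"
    using assms(1) by auto
  have finE: "finite ?E"
    by (simp add: arcs_ends_def)
  have sub: "?I \<subseteq> ?V" "?O \<subseteq> ?V" and cards: "card ?I = k" "card ?O = k"
    using assms(2) by (auto simp: in_out_graph_def card_image)
  have cV: "card (?V - ?O) = k - 1" "card (?V - ?I) = k - 1"
    using assms(3) sub cards by (simp_all add: card_Diff_subset)
  have "2 * card (?V - ?O) \<le> card (?E \<inter> (?V - ?O) \<times> ?I)"
    by (intro card_restrict_ge_two_mult two_le_card_if_avoiding[OF J]
        out_neighbour_in_inc[OF assms(2,3)]) simp_all
  \<comment> \<open>Reversing the arcs turns in-neighbours into out-neighbours, so the same counting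
    lemma applies.\<close>
  moreover have "2 * card (?V - ?I) \<le> card (?E\<inverse> \<inter> (?V - ?I) \<times> ?O)"
  proof (intro card_restrict_ge_two_mult two_le_card_if_avoiding[OF J])
    fix y j assume "y \<in> ?V - ?I" "j \<in> {1..k}"
    then show "\<exists>x\<in>?O. x \<noteq> out j \<and> (y, x) \<in> ?E\<inverse>"
      unfolding converse_iff by (intro in_neighbour_in_out[OF assms(2,3)]) simp_all
  qed simp_all
  moreover have "card (?E\<inverse> \<inter> (?V - ?I) \<times> ?O) = card (?E \<inter> ?O \<times> (?V - ?I))"
    by (metis card_inverse converse_Int converse_Times converse_converse)
  moreover have "card (?E \<inter> (?V - ?O) \<times> ?I) + card (?E \<inter> ?O \<times> (?V - ?I)) \<le> card ?E"
    using finE by (subst card_Un_disjoint[symmetric]) (auto intro!: card_mono)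
  \<comment> \<open>There are no parallel arcs, so an arc is determined by its pair of ends.\<close>
  moreover have "card ?E = card (arcs S)"
    unfolding arcs_ends_def by (rule card_image[OF inj_on_arc_to_ends])
  ultimately show ?thesis
    using cV by simp
qed

end
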